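(* Let $F \subseteq \mathbb{N}$ be the set of natural numbers whose base-$2$ expansion has even length and begins with $11$, and let $A = \mathbb{N} \setminus F$. Then the sequence $(r(3, A, n))_{n \geq 0}$ is strictly increasing, i.e., $r(3,A,n) < r(3,A,n+1)$ for all $n \geq 0$.
   Context: $\mathbb{N} = \{0,1,2,\ldots\}$. For a set $A \subseteq \mathbb{N}$ and integers $k \geq 1$, $n \geq 0$, $r(k,A,n)$ denotes the number of (ordered) $k$-tuples $(a_1,\ldots,a_k)$ of elements of $A$, not necessarily distinct, with $a_1 + \cdots + a_k = n$. Base-$2$ expansions are written without leading zeros, most significant digit first; thus $F = \{3,12,13,14,15,48,49,50,\ldots,63,192,\ldots\} = \bigcup_{i \geq 0} \{m \in \mathbb{N} : 3\cdot 4^i \leq m < 4^{i+1}\}$. *)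

theory Defs
  imports Main
begin

text \<open>Base-2 digits, most significant first and without leading zeros; \<open>0\<close> has the empty expansion.\<close>

fun binary_digits :: "nat \<Rightarrow> nat list" where
  "binary_digits n = (if n = 0 then [] else binary_digits (n div 2) @ [n mod 2])"

declare binary_digits.simps [simp del]

definition F :: "nat set" where
  "F = {m. even (length (binary_digits m)) \<and> (\<exists>ds. binary_digits m = [1, 1] @ ds)}"

definition rep_count :: "nat \<Rightarrow> nat set \<Rightarrow> nat \<Rightarrow> nat" where
  "rep_count k A n = card {as. length as = k \<and> set as \<subseteq> A \<and> sum_list as = n}"

end

theory Submission
  imports Defs "HOL-Computational_Algebra.Formal_Laurent_Series"
begin

text \<open>
  Membership in \<open>F\<close> is decided by the leading base-4 digit: \<open>F\<close> consists of the numbers whose base-4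
  expansion starts with 3. Appending a base-4 digit to a positive number therefore does not change
  membership, and the generating function \<open>a(x)\<close> of the complement \<open>A\<close> satisfies
  \<open>a(x) = (1 + x + x^2 + x^3) a(x^4) - x^3\<close> (lemma \<open>a_series_functional_equation\<close>).

  Let \<open>d\<^sub>k(n)\<close> be the coefficients of \<open>(1 - x) a(x)^k\<close>, that is, the first differences of the number of
  representations of \<open>n\<close> as a sum of \<open>k\<close> elements of \<open>A\<close>; the claim is \<open>d\<^sub>3(n) > 0\<close> for \<open>n > 0\<close>. Expanding the
  powers of the functional equation and using \<open>1 - x^4 = (1 - x) (1 + x + x^2 + x^3)\<close> gives functional
  equations for these series, hence recurrences that express the values at \<open>4 m + r\<close>, \<open>0 \<le> r < 4\<close>,
  through values near \<open>m\<close>. In them \<open>d\<^sub>3\<close> reproduces itself with total weight 4, so it wants to grow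
  linearly, and it is disturbed only by \<open>d\<^sub>2\<close> and \<open>d\<^sub>1\<close>.

  These disturbances are bounded. The recurrence for \<open>d\<^sub>2\<close> has weight 1 and, apart from corrections at 6
  and 7, picks up an increment only from \<open>d\<^sub>1\<close>, which is at least \<open>- 1\<close>; and where \<open>d\<^sub>1\<close> is negative,
  \<open>d\<^sub>2\<close> equals \<open>- 1\<close>, so that \<open>d\<^sub>2 \<le> 2\<close> persists (lemma \<open>diff_series_2_bounds\<close>). Consequently, if
  \<open>d\<^sub>3 \<ge> c\<close> at \<open>m - 1\<close> and \<open>m\<close>, then \<open>d\<^sub>3 \<ge> 4 c - 9\<close> at \<open>4 m + r\<close>, and \<open>c = 3\<close> is self-sustaining.
  The bound \<open>d\<^sub>3 \<ge> 3\<close> holds from \<open>n = 5\<close> on (lemma \<open>diff_series_3_ge_3\<close>); a table of the first 24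
  values starts the induction.
\<close>

unbundle fps_syntax

section \<open>Membership in \<open>F\<close> by base-4 digits\<close>

lemma binary_digits_div_4:
  assumes "4 \<le> n"
  shows "binary_digits n = binary_digits (n div 4) @ [n div 2 mod 2, n mod 2]"
proof -
  have "binary_digits n = binary_digits (n div 2) @ [n mod 2]"
    using assms by (subst binary_digits.simps) simp
  also have "binary_digits (n div 2) = binary_digits (n div 4) @ [n div 2 mod 2]"
    using assms by (subst binary_digits.simps) (simp add: div_mult2_eq [symmetric])
  finally show ?thesis by simp
qed

lemma mem_F_less_4:
  assumes "n < 4"
  shows "n \<in> F \<longleftrightarrow> n = 3"
proof -
  consider "n = 0" | "n = 1" | "n = 2" | "n = 3"
    using assms by linarith
  then show ?thesis
    by cases (simp_all add: F_def binary_digits.simps)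
qed

text \<open>
  Passing to \<open>n div 4\<close> drops two binary digits, which preserves the parity of the length. It could
  disturb the leading two digits only if a single digit remained, and then both lengths are odd.
\<close>

lemma mem_F_div_4:
  assumes "4 \<le> n"
  shows "n \<in> F \<longleftrightarrow> n div 4 \<in> F"
proof -
  define ds where "ds = binary_digits (n div 4)"
  have "ds \<noteq> []"
    using assms by (simp add: ds_def binary_digits.simps [of "n div 4"])
  then consider d where "ds = [d]" | d d' ds' where "ds = d # d' # ds'"
    by (metis list.exhaust)
  then show ?thesis
    by cases (simp_all add: F_def binary_digits_div_4 [OF assms] flip: ds_def)
qed

section \<open>The generating function of the complement of \<open>F\<close>\<close>

definition indicator_series :: "nat set \<Rightarrow> int fps" where
  "indicator_series S = Abs_fps (\<lambda>n. if n \<in> S then 1 else 0)"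

lemma power_indicator_series_nth:
  assumes "0 < k"
  shows "indicator_series S ^ k $ n = int (rep_count k S n)"
proof -
  have *: "(\<Prod>j\<in>{0..k - 1}. indicator_series S $ (v ! j)) = (if set v \<subseteq> S then 1 else 0)"
    if "v \<in> natpermute n k" for v
  proof -
    have "length v = k"
      using that by (simp add: natpermute_def)
    moreover have "{0..k - 1} = {..<k}"
      using assms by auto
    ultimately have "(\<Prod>j\<in>{0..k - 1}. indicator_series S $ (v ! j))
        = (if \<forall>j<k. v ! j \<in> S then 1 else 0)"
      by (auto simp: indicator_series_def)
    then show ?thesis
      using \<open>length v = k\<close> by (auto simp: set_conv_nth subset_iff)
  qed
  have "indicator_series S ^ k $ n = (\<Sum>v\<in>natpermute n k. if set v \<subseteq> S then 1 else 0)"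
    using assms * by (simp add: fps_power_nth)
  also have "\<dots> = int (card {v \<in> natpermute n k. set v \<subseteq> S})"
    by (simp add: sum.If_cases natpermute_finite Int_def)
  also have "{v \<in> natpermute n k. set v \<subseteq> S} = {v. length v = k \<and> set v \<subseteq> S \<and> sum_list v = n}"
    by (auto simp: natpermute_def)
  finally show ?thesis
    by (simp add: rep_count_def)
qed

abbreviation stretch4 :: "int fps \<Rightarrow> int fps" where
  "stretch4 f \<equiv> f oo fps_X ^ 4"

text \<open>
  The conditions are phrased with quotients and remainders by 4 so that for \<open>n\<close> of the form
  \<open>4 * m + r\<close> and numerals \<open>j\<close> and \<open>r\<close> they are decided by simplification.
\<close>

lemma shift_stretch4_nth:
  "(fps_X ^ j * stretch4 f) $ n =
     (if j div 4 \<le> n div 4 \<and> n mod 4 = j mod 4 then f $ (n div 4 - j div 4) else 0)"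
proof -
  have "j \<le> n \<and> 4 dvd n - j \<longleftrightarrow> j div 4 \<le> n div 4 \<and> n mod 4 = j mod 4"
  proof
    assume "j \<le> n \<and> 4 dvd n - j"
    then show "j div 4 \<le> n div 4 \<and> n mod 4 = j mod 4"
      using mod_eq_dvd_iff_nat [of j n 4] by (simp add: div_le_mono)
  next
    assume *: "j div 4 \<le> n div 4 \<and> n mod 4 = j mod 4"
    moreover have "j \<le> n"
      using * div_mult_mod_eq [of n 4] div_mult_mod_eq [of j 4] by linarith
    ultimately show "j \<le> n \<and> 4 dvd n - j"
      using mod_eq_dvd_iff_nat [of j n 4] by simp
  qed
  moreover have "(n - j) div 4 = n div 4 - j div 4" if "4 dvd n - j" "j \<le> n"
  proof -
    from that obtain c where "n = j + 4 * c"
      by (metis dvdE le_add_diff_inverse)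
    then show ?thesis by simp
  qed
  ultimately show ?thesis
    by (auto simp: fps_X_power_mult_nth fps_nth_compose_X_power)
qed

lemma X_power_nth_div_mod_4:
  "(fps_X ^ j :: int fps) $ n = (if n div 4 = j div 4 \<and> n mod 4 = j mod 4 then 1 else 0)"
  by (metis div_mult_mod_eq fps_X_power_nth)

abbreviation a_series :: "int fps" where
  "a_series \<equiv> indicator_series (UNIV - F)"

text \<open>
  Multiplication by \<open>1 + x + x^2 + x^3\<close> after stretching appends an arbitrary base-4 digit. Among the
  extensions of elements of \<open>A\<close>, only 3, which extends the empty expansion of 0, fails to be in \<open>A\<close>.
\<close>

lemma a_series_functional_equation:
  "a_series = (1 + fps_X + fps_X ^ 2 + fps_X ^ 3) * stretch4 a_series - fps_X ^ 3"
proof (rule fps_ext)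
  fix n :: nat
  let ?P = "1 + fps_X + fps_X ^ 2 + fps_X ^ 3 :: int fps"
  have eq: "?P * stretch4 a_series = fps_X ^ 0 * stretch4 a_series + fps_X ^ 1 * stretch4 a_series
      + fps_X ^ 2 * stretch4 a_series + fps_X ^ 3 * stretch4 a_series"
    by (simp add: algebra_simps)
  have "n mod 4 \<in> {0, 1, 2, 3}"
    by auto
  then have coeff: "(?P * stretch4 a_series) $ n = a_series $ (n div 4)"
    unfolding eq fps_add_nth shift_stretch4_nth by auto
  show "a_series $ n = (?P * stretch4 a_series - fps_X ^ 3) $ n"
  proof (cases "4 \<le> n")
    case True
    then show ?thesis
      by (simp add: coeff) (simp add: indicator_series_def mem_F_div_4 [OF True])
  next
    case False
    then show ?thesis
      by (simp add: coeff) (simp add: indicator_series_def mem_F_less_4)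
  qed
qed

section \<open>Recurrences for the first differences\<close>

definition diff_series :: "nat \<Rightarrow> int fps" where
  "diff_series k = (1 - fps_X) * a_series ^ k"

lemma diff_series_nth_0: "diff_series k $ 0 = 1"
  by (simp add: diff_series_def indicator_series_def mem_F_less_4 fps_power_zeroth)

lemma diff_series_nth_Suc: "diff_series k $ Suc n = a_series ^ k $ Suc n - a_series ^ k $ n"
  by (simp add: diff_series_def left_diff_distrib)

lemma stretch4_diff_series:
  "stretch4 (diff_series k) = (1 - fps_X ^ 4) * stretch4 a_series ^ k"
  by (simp add: diff_series_def fps_compose_mult_distrib fps_compose_power fps_compose_sub_distrib)

lemma one_minus_X_power_4:
  "(1 - fps_X ^ 4 :: int fps) = (1 - fps_X) * (1 + fps_X + fps_X ^ 2 + fps_X ^ 3)"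
  by (simp add: algebra_simps power_numeral_reduce)

text \<open>
  The right-hand sides stay linear in the stretched difference series: every term of the expanded power
  that contains \<open>a(x^4)\<close> also contains \<open>P\<close>, and \<open>(1 - x) P\<close> is the factor \<open>1 - x^4\<close> of the
  stretched difference series.
\<close>

lemma diff_series_functional_equations:
  fixes P :: "int fps"
  defines "P \<equiv> 1 + fps_X + fps_X ^ 2 + fps_X ^ 3"
  shows "diff_series 1 = stretch4 (diff_series 1) - fps_X ^ 3 + fps_X ^ 4"
    and "diff_series 2 = P * stretch4 (diff_series 2) - 2 * fps_X ^ 3 * stretch4 (diff_series 1)
           + fps_X ^ 6 - fps_X ^ 7"
    and "diff_series 3 = P ^ 2 * stretch4 (diff_series 3)
           - 3 * fps_X ^ 3 * P * stretch4 (diff_series 2)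
           + 3 * fps_X ^ 6 * stretch4 (diff_series 1) - fps_X ^ 9 + fps_X ^ 10"
proof -
  have a: "a_series = P * stretch4 a_series - fps_X ^ 3"
    unfolding P_def by (rule a_series_functional_equation)
  have E: "diff_series k = (1 - fps_X) * (P * stretch4 a_series - fps_X ^ 3) ^ k" for k
    unfolding diff_series_def by (subst a) simp
  have S: "stretch4 (diff_series k) = (1 - fps_X) * P * stretch4 a_series ^ k" for k
    unfolding P_def stretch4_diff_series one_minus_X_power_4 by simp
  show "diff_series 1 = stretch4 (diff_series 1) - fps_X ^ 3 + fps_X ^ 4"
    unfolding S unfolding E by (simp add: power_numeral_reduce algebra_simps)
  show "diff_series 2 = P * stretch4 (diff_series 2) - 2 * fps_X ^ 3 * stretch4 (diff_series 1)
           + fps_X ^ 6 - fps_X ^ 7"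
    unfolding S unfolding E by (simp add: power_numeral_reduce algebra_simps)
  show "diff_series 3 = P ^ 2 * stretch4 (diff_series 3)
           - 3 * fps_X ^ 3 * P * stretch4 (diff_series 2)
           + 3 * fps_X ^ 6 * stretch4 (diff_series 1) - fps_X ^ 9 + fps_X ^ 10"
    unfolding S unfolding E by (simp add: power_numeral_reduce algebra_simps)
qed

text \<open>
  In the next three lemmas the functional equations are multiplied out into sums of shifted stretched
  series, from which coefficients can be read off term by term.
\<close>

lemma diff_series_1_eq:
  "diff_series 1 = fps_X ^ 0 * stretch4 (diff_series 1) - fps_X ^ 3 + fps_X ^ 4"
  using diff_series_functional_equations(1) by simp

lemma diff_series_2_eq:
  "diff_series 2 =
     fps_X ^ 0 * stretch4 (diff_series 2) + fps_X ^ 1 * stretch4 (diff_series 2)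
     + fps_X ^ 2 * stretch4 (diff_series 2) + fps_X ^ 3 * stretch4 (diff_series 2)
     - fps_const 2 * (fps_X ^ 3 * stretch4 (diff_series 1)) + fps_X ^ 6 - fps_X ^ 7"
  unfolding numeral_fps_const [symmetric]
  by (subst diff_series_functional_equations(2)) (simp add: power_numeral_reduce algebra_simps)

lemma diff_series_3_eq:
  "diff_series 3 =
     fps_X ^ 0 * stretch4 (diff_series 3) + fps_const 2 * (fps_X ^ 1 * stretch4 (diff_series 3))
     + fps_const 3 * (fps_X ^ 2 * stretch4 (diff_series 3))
     + fps_const 4 * (fps_X ^ 3 * stretch4 (diff_series 3))
     + fps_const 3 * (fps_X ^ 4 * stretch4 (diff_series 3))
     + fps_const 2 * (fps_X ^ 5 * stretch4 (diff_series 3)) + fps_X ^ 6 * stretch4 (diff_series 3)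
     - fps_const 3 * (fps_X ^ 3 * stretch4 (diff_series 2))
     - fps_const 3 * (fps_X ^ 4 * stretch4 (diff_series 2))
     - fps_const 3 * (fps_X ^ 5 * stretch4 (diff_series 2))
     - fps_const 3 * (fps_X ^ 6 * stretch4 (diff_series 2))
     + fps_const 3 * (fps_X ^ 6 * stretch4 (diff_series 1)) - fps_X ^ 9 + fps_X ^ 10"
  unfolding numeral_fps_const [symmetric]
  by (subst diff_series_functional_equations(3)) (simp add: power_numeral_reduce algebra_simps)

lemma diff_series_1_rec:
  "diff_series 1 $ (4 * m) = diff_series 1 $ m + (if m = 1 then 1 else 0)"
  "diff_series 1 $ (4 * m + 1) = 0"
  "diff_series 1 $ (4 * m + 2) = 0"
  "diff_series 1 $ (4 * m + 3) = (if m = 0 then - 1 else 0)"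
  by (subst diff_series_1_eq, simp only: fps_add_nth fps_sub_nth 
      shift_stretch4_nth X_power_nth_div_mod_4,
      simp add: mod_Suc div_Suc)+

lemma diff_series_2_rec:
  "diff_series 2 $ (4 * m) = diff_series 2 $ m"
  "diff_series 2 $ (4 * m + 1) = diff_series 2 $ m"
  "diff_series 2 $ (4 * m + 2) = diff_series 2 $ m + (if m = 1 then 1 else 0)"
  "diff_series 2 $ (4 * m + 3) = diff_series 2 $ m - 2 * diff_series 1 $ m - (if m = 1 then 1 else 0)"
  by (subst diff_series_2_eq,
      simp only: fps_add_nth fps_sub_nth fps_mult_left_const_nth 
      shift_stretch4_nth X_power_nth_div_mod_4,
      simp add: mod_Suc div_Suc)+

lemma diff_series_3_less_4:
  "diff_series 3 $ 1 = 2" "diff_series 3 $ 2 = 3" "diff_series 3 $ 3 = 1"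
  by (subst diff_series_3_eq,
      simp only: fps_add_nth fps_sub_nth fps_mult_left_const_nth 
      shift_stretch4_nth X_power_nth_div_mod_4,
      simp add: diff_series_nth_0)+

text \<open>
  The weights of \<open>d\<^sub>3\<close> are the coefficients 1, 2, 3, 4, 3, 2, 1 of \<open>(1 + x + x^2 + x^3)^2\<close>, sorted by
  the residue of the exponent modulo 4. The isolated corrections are those of \<open>x^9\<close> and \<open>x^10\<close>.
\<close>

lemma diff_series_3_rec:
  "diff_series 3 $ (4 * Suc m) =
     diff_series 3 $ Suc m + 3 * diff_series 3 $ m - 3 * diff_series 2 $ m"
  "diff_series 3 $ (4 * Suc m + 1) =
     2 * diff_series 3 $ Suc m + 2 * diff_series 3 $ m - 3 * diff_series 2 $ m
     - (if m = 1 then 1 else 0)"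
  "diff_series 3 $ (4 * Suc m + 2) =
     3 * diff_series 3 $ Suc m + diff_series 3 $ m - 3 * diff_series 2 $ m
     + 3 * diff_series 1 $ m + (if m = 1 then 1 else 0)"
  "diff_series 3 $ (4 * Suc m + 3) =
     4 * diff_series 3 $ Suc m - 3 * diff_series 2 $ Suc m"
  by (subst diff_series_3_eq,
      simp only: fps_add_nth fps_sub_nth fps_mult_left_const_nth 
      shift_stretch4_nth X_power_nth_div_mod_4,
      simp add: mod_Suc div_Suc)+

section \<open>Positivity\<close>

lemma mod_4_cases:
  fixes n :: nat
  obtains m where "n = 4 * m" | m where "n = 4 * m + 1"
    | m where "n = 4 * m + 2" | m where "n = 4 * m + 3"
proof -
  have "\<exists>m. n = 4 * m \<or> n = 4 * m + 1 \<or> n = 4 * m + 2 \<or> n = 4 * m + 3"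
    by presburger
  then show thesis
    using that by blast
qed

lemma diff_series_1_ge: "- 1 \<le> diff_series 1 $ n"
proof (induction n rule: less_induct)
  case (less n)
  show ?case
  proof (cases n rule: mod_4_cases)
    case (1 m)
    then show ?thesis
      using less [of m] diff_series_1_rec(1) [of m]
      by (cases "m = 0") (auto simp: diff_series_nth_0)
  qed (use diff_series_1_rec in auto)
qed

text \<open>
  The second conjunct is what keeps the induction going: in the recurrence for \<open>d\<^sub>2\<close> at \<open>4 m + 3\<close>, the
  term \<open>- 2 d\<^sub>1(m)\<close> can raise the value only where \<open>d\<^sub>1(m) = - 1\<close>, and there it leads from \<open>- 1\<close> to at
  most 1. It is inherited because \<open>d\<^sub>1\<close> is negative only at 3 and along multiplication by 4, which
  leaves \<open>d\<^sub>2\<close> unchanged. The value 2 itself first occurs at 6, through the correction \<open>x^6\<close>.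
\<close>

lemma diff_series_2_bounds:
  "diff_series 2 $ n \<le> 2 \<and> (diff_series 1 $ n < 0 \<longrightarrow> diff_series 2 $ n = - 1)"
proof (induction n rule: less_induct)
  case (less n)
  have small: "diff_series 1 $ 1 = 0" "diff_series 2 $ 1 = 1"
    using diff_series_1_rec(2) [of 0] diff_series_2_rec(2) [of 0]
    by (simp_all add: diff_series_nth_0)
  show ?case
  proof (cases n rule: mod_4_cases)
    case (1 m)
    then show ?thesis
      using less [of m] diff_series_1_rec(1) [of m] diff_series_2_rec(1) [of m] small
      by (cases "m = 0") (auto simp: diff_series_nth_0 split: if_splits)
  next
    case (2 m)
    then show ?thesis
      using less [of m] diff_series_1_rec(2) [of m] diff_series_2_rec(2) [of m] by auto
  next
    case (3 m)
    then show ?thesis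
      using less [of m] diff_series_1_rec(3) [of m] diff_series_2_rec(3) [of m] small by auto
  next
    case (4 m)
    then show ?thesis
      using less [of m] diff_series_1_rec(4) [of m] diff_series_2_rec(4) [of m] small
        diff_series_1_ge [of m]
      by (cases "m = 0"; cases "diff_series 1 $ m < 0") (auto simp: diff_series_nth_0)
  qed
qed

text \<open>
  The range is dictated by the induction that follows: it descends from \<open>n\<close> to \<open>n div 4 - 1\<close>, which
  has to be at least 5, because \<open>d\<^sub>3(3) = 1\<close> and \<open>d\<^sub>3(4) = 2\<close> violate the lower bound 3.
\<close>

lemma diff_series_3_pos_less_24:
  assumes "n < 24"
  shows "0 < diff_series 3 $ n" "5 \<le> n \<Longrightarrow> 3 \<le> diff_series 3 $ n"
proof -
  have two: "Suc (Suc 0) = 2"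
    by simp
  have e1: "diff_series 1 $ 0 = 1" "diff_series 1 $ 1 = 0" "diff_series 1 $ 2 = 0"
      "diff_series 1 $ 3 = - 1" "diff_series 1 $ 4 = 1"
    using diff_series_1_rec [of 0] diff_series_1_rec(1) [of 1]
    by (simp_all add: diff_series_nth_0 two)
  have e2: "diff_series 2 $ 0 = 1" "diff_series 2 $ 1 = 1" "diff_series 2 $ 2 = 1"
      "diff_series 2 $ 3 = - 1" "diff_series 2 $ 4 = 1" "diff_series 2 $ 5 = 1"
    using diff_series_2_rec [of 0] diff_series_2_rec [of 1] e1
    by (simp_all add: diff_series_nth_0 two)
  have d0: "diff_series 3 $ 0 = 1"
    by (rule diff_series_nth_0)
  note d1 = diff_series_3_less_4
  have d4: "diff_series 3 $ 4 = 2" "diff_series 3 $ 5 = 3" "diff_series 3 $ 6 = 7"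
      "diff_series 3 $ 7 = 5"
    using diff_series_3_rec [of 0] d0 d1 e1 e2 by simp_all
  have d8: "diff_series 3 $ 8 = 6" "diff_series 3 $ 9 = 6" "diff_series 3 $ 10 = 9"
      "diff_series 3 $ 11 = 9"
    using diff_series_3_rec [of 1] d1 e1 e2 by (simp_all add: two)
  have d12: "diff_series 3 $ 12 = 7" "diff_series 3 $ 13 = 5" "diff_series 3 $ 14 = 3"
      "diff_series 3 $ 15 = 7"
    using diff_series_3_rec [of 2] d1 e1 e2 by simp_all
  have d16: "diff_series 3 $ 16 = 8" "diff_series 3 $ 17 = 9" "diff_series 3 $ 18 = 7"
      "diff_series 3 $ 19 = 5"
    using diff_series_3_rec [of 3] d1 d4 e1 e2 by simp_all
  have d20: "diff_series 3 $ 20 = 6" "diff_series 3 $ 21 = 7" "diff_series 3 $ 22 = 11"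
      "diff_series 3 $ 23 = 9"
    using diff_series_3_rec [of 4] d4 e1 e2 by simp_all
  have "n \<in> {0, 1, 2, 3, 4, 5, 6, 7, 8, 9, 10, 11, 12, 13, 14, 15, 16, 17, 18, 19, 20, 21, 22, 23}"
    using assms by simp presburger
  then show "0 < diff_series 3 $ n" "5 \<le> n \<Longrightarrow> 3 \<le> diff_series 3 $ n"
    using d0 d1 d4 d8 d12 d16 d20 by auto
qed

text \<open>
  With \<open>d\<^sub>2 \<le> 2\<close> and \<open>d\<^sub>1 \<ge> - 1\<close>, the recurrences turn a lower bound \<open>c\<close> into at least
  \<open>4 c - 3 * 2 - 3\<close>, and 3 is the least \<open>c\<close> that reproduces itself.
\<close>

lemma diff_series_3_ge_3:
  assumes "5 \<le> n"
  shows "3 \<le> diff_series 3 $ n"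
  using assms
proof (induction n rule: less_induct)
  case (less n)
  show ?case
  proof (cases "n < 24")
    case True
    then show ?thesis
      using less.prems diff_series_3_pos_less_24(2) by simp
  next
    case False
    define m where "m = n div 4 - 1"
    have "5 \<le> m" "Suc m < n"
      using False by (simp_all add: m_def)
    then have IH: "3 \<le> diff_series 3 $ m" "3 \<le> diff_series 3 $ Suc m"
      using less.IH by simp_all
    have bounds: "diff_series 2 $ m \<le> 2" "diff_series 2 $ Suc m \<le> 2" "- 1 \<le> diff_series 1 $ m"
      using diff_series_2_bounds diff_series_1_ge by blast+
    have "n = 4 * Suc m + n mod 4" "n mod 4 \<in> {0, 1, 2, 3}"
      using False by (auto simp: m_def)
    then consider "n = 4 * Suc m" | "n = 4 * Suc m + 1" | "n = 4 * Suc m + 2" | "n = 4 * Suc m + 3"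
      by fastforce
    then show ?thesis
      using IH bounds diff_series_3_rec [of m] \<open>5 \<le> m\<close> by cases simp_all
  qed
qed

theorem theorem2:
  "strict_mono (rep_count 3 (UNIV - F))"
proof (rule strict_mono_Suc_iff [THEN iffD2], rule allI)
  fix n
  have "0 < diff_series 3 $ Suc n"
    using diff_series_3_pos_less_24(1) [of "Suc n"] diff_series_3_ge_3 [of "Suc n"]
    by (cases "Suc n < 5") simp_all
  then show "rep_count 3 (UNIV - F) n < rep_count 3 (UNIV - F) (Suc n)"
    by (simp add: diff_series_nth_Suc power_indicator_series_nth)
qed

end
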